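(* Let $A_n : NC^{\mathrm{(mton)}}_2(2n) \to \mathbb{R}$ be $A_n(\pi,u) := \mathrm{area}(\pi)$, where $NC^{\mathrm{(mton)}}_2(2n)$ carries the uniform distribution. Then $$E[A_n] = (2n+1)\sum_{k=1}^n \frac{1}{2k+1}, \qquad n \in \mathbb{N},$$ and consequently $E[A_n] \sim n\ln n$ as $n \to \infty$.
   Context: $NC_2(2n)$ is the set of non-crossing pair-partitions of $\{1,\ldots,2n\}$. For blocks $V,W$, "$V$ nested inside $W$" means $\min V > \min W$ and $\max V < \max W$. A monotonic ordering of $\pi \in NC_2(2n)$ is a bijection $u:\pi\to\{1,\ldots,n\}$ with $u(V)>u(W)$ whenever $V$ is nested inside $W$; $NC^{\mathrm{(mton)}}_2(2n)$ is the set of pairs $(\pi,u)$ with $\pi\in NC_2(2n)$ and $u$ a monotonic ordering. For $\pi \in NC_2(2n)$, $f_\pi:[0,2n]\to\mathbb{R}$ is the continuous function with $f_\pi(0)=0$, linear on each $[m-1,m]$ ($1\le m\le 2n$), with slope $+1$ on $[i-1,i]$ and slope $-1$ on $[j-1,j]$ for every pair $\{i,j\}\in\pi$ with $i<j$; $\mathrm{area}(\pi) := \int_0^{2n} f_\pi(t)\,dt$. *)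

theory Defs
  imports
    "HOL-Probability.Probability"
    "HOL-Library.Disjoint_Sets"
    "HOL-Library.Landau_Symbols"
begin

definition non_crossing :: "nat set set \<Rightarrow> bool" where
  "non_crossing \<pi> \<longleftrightarrow>
     \<not> (\<exists>V\<in>\<pi>. \<exists>W\<in>\<pi>. V \<noteq> W \<and>
          (\<exists>a b c d. a < b \<and> b < c \<and> c < d \<and> a \<in> V \<and> c \<in> V \<and> b \<in> W \<and> d \<in> W))"

text \<open>The argument is the size of the underlying set, so the non-crossing pair-partitions
  of \<open>{1..2*n}\<close> are \<open>NC2 (2 * n)\<close>.\<close>

definition NC2 :: "nat \<Rightarrow> nat set set set" where
  "NC2 m = {\<pi>. partition_on {1..m} \<pi> \<and> (\<forall>V\<in>\<pi>. card V = 2) \<and> non_crossing \<pi>}"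

definition nested_inside :: "nat set \<Rightarrow> nat set \<Rightarrow> bool" where
  "nested_inside V W \<longleftrightarrow> Min V > Min W \<and> Max V < Max W"

text \<open>Orderings are taken to be \<^const>\<open>extensional\<close> (equal to \<^const>\<open>undefined\<close> outside \<open>\<pi>\<close>),
  so that each bijection from \<open>\<pi>\<close> to \<open>{1..n}\<close> is represented by exactly one HOL function.\<close>

definition monotonic_ordering :: "nat \<Rightarrow> nat set set \<Rightarrow> (nat set \<Rightarrow> nat) \<Rightarrow> bool" where
  "monotonic_ordering n \<pi> u \<longleftrightarrow>
     u \<in> extensional \<pi> \<and> bij_betw u \<pi> {1..n} \<and>
     (\<forall>V\<in>\<pi>. \<forall>W\<in>\<pi>. nested_inside V W \<longrightarrow> u V > u W)"

definition NC2_mton :: "nat \<Rightarrow> (nat set set \<times> (nat set \<Rightarrow> nat)) set" where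
  "NC2_mton n = {(\<pi>, u). \<pi> \<in> NC2 (2 * n) \<and> monotonic_ordering n \<pi> u}"

definition slope :: "nat set set \<Rightarrow> nat \<Rightarrow> real" where
  "slope \<pi> m = (if \<exists>j>m. {m, j} \<in> \<pi> then 1 else - 1)"

text \<open>The piecewise linear function \<open>f\<^sub>\<pi>\<close>. Only its values on \<open>{0..2*n}\<close> matter; that they are the
  ones of the intended continuous function is \<open>path_fun_iff\<close> below.\<close>

definition path_fun :: "nat set set \<Rightarrow> real \<Rightarrow> real" where
  "path_fun \<pi> t = (\<Sum>m=1..nat \<lfloor>t\<rfloor>. slope \<pi> m) + slope \<pi> (nat \<lfloor>t\<rfloor> + 1) * frac t"

definition area :: "nat \<Rightarrow> nat set set \<Rightarrow> real" where
  "area n \<pi> = integral {0..real (2 * n)} (path_fun \<pi>)"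

definition A :: "nat \<Rightarrow> nat set set \<times> (nat set \<Rightarrow> nat) \<Rightarrow> real" where
  "A n = (\<lambda>(\<pi>, u). area n \<pi>)"

lemma path_fun_linear:
  assumes "m \<ge> 1" "t \<in> {real m - 1..real m}"
  shows "path_fun \<pi> t = path_fun \<pi> (real m - 1) + slope \<pi> m * (t - (real m - 1))"
proof -
  obtain k where k: "m = Suc k" using assms(1) by (cases m) auto
  show ?thesis
  proof (cases "t = real m")
    case True
    have "path_fun \<pi> (real j) = (\<Sum>m=1..j. slope \<pi> m)" for j
      by (simp add: path_fun_def)
    from this[of k] this[of "Suc k"] show ?thesis using True k by simp
  next
    case False
    then have "real k \<le> t" "t < real k + 1" using assms(2) k by auto
    then have fl: "\<lfloor>t\<rfloor> = int k" by (simp add: floor_eq_iff)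
    show ?thesis by (simp add: path_fun_def fl k frac_def)
  qed
qed

lemma path_fun_0: "path_fun \<pi> 0 = 0"
  by (simp add: path_fun_def)

lemma continuous_path_fun: "continuous_on {0..real N} (path_fun \<pi>)"
proof (induction N)
  case 0
  then show ?case by simp
next
  case (Suc N)
  have eq: "{0..real (Suc N)} = {0..real N} \<union> {real N..real (Suc N)}" by auto
  have "continuous_on {real N..real (Suc N)}
     (\<lambda>t. path_fun \<pi> (real (Suc N) - 1) + slope \<pi> (Suc N) * (t - (real (Suc N) - 1)))"
    by (intro continuous_intros)
  then have "continuous_on {real N..real (Suc N)} (path_fun \<pi>)"
    by (subst continuous_on_cong[OF refl path_fun_linear[of "Suc N"]]) auto
  then show ?case unfolding eq by (intro continuous_on_closed_Un Suc) auto
qed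

lemma NC2_cover:
  assumes "\<pi> \<in> NC2 N" "m \<in> {1..N}"
  shows "\<exists>i j. i < j \<and> {i, j} \<in> \<pi> \<and> (m = i \<or> m = j)"
proof -
  obtain V where V: "V \<in> \<pi>" "m \<in> V"
    using assms unfolding NC2_def partition_on_def by blast
  moreover have "card V = 2" using V assms unfolding NC2_def by blast
  then obtain x y where "V = {x, y}" "x \<noteq> y" by (auto simp: card_2_iff)
  ultimately show ?thesis by (metis insert_commute insert_iff linorder_less_linear singletonD)
qed

lemma NC2_slope:
  assumes "\<pi> \<in> NC2 N" "{i, j} \<in> \<pi>" "i < j"
  shows "slope \<pi> i = 1" "slope \<pi> j = - 1" "i \<in> {1..N}" "j \<in> {1..N}"
proof -
  show "slope \<pi> i = 1" using assms by (auto simp: slope_def)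
  have "{j, k} \<notin> \<pi>" if "j < k" for k
  proof
    assume *: "{j, k} \<in> \<pi>"
    have "disjoint \<pi>" using assms(1) by (auto simp: NC2_def partition_on_def)
    then have "{j, k} \<inter> {i, j} = {} \<or> {j, k} = {i, j}"
      using disjointD[OF _ * assms(2)] by blast
    then have "k = i" using that by (auto simp: doubleton_eq_iff)
    with that assms(3) show False by simp
  qed
  then show "slope \<pi> j = - 1" by (auto simp: slope_def)
  show "i \<in> {1..N}" "j \<in> {1..N}" using assms unfolding NC2_def partition_on_def by blast+
qed

lemma path_fun_iff:
  assumes \<pi>: "\<pi> \<in> NC2 (2 * n)"
  shows "(\<forall>t\<in>{0..real (2 * n)}. f t = path_fun \<pi> t) \<longleftrightarrow>
    continuous_on {0..real (2 * n)} f \<and> f 0 = 0 \<and>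
    (\<forall>i j. {i, j} \<in> \<pi> \<and> i < j \<longrightarrow>
      (\<forall>t\<in>{real i - 1..real i}. f t = f (real i - 1) + (t - (real i - 1))) \<and>
      (\<forall>t\<in>{real j - 1..real j}. f t = f (real j - 1) - (t - (real j - 1))))"
    (is "?L \<longleftrightarrow> ?R")
proof
  assume L: ?L
  have lin: "f t = f (real m - 1) + slope \<pi> m * (t - (real m - 1))"
    if "m \<in> {1..2*n}" "t \<in> {real m - 1..real m}" for m t
  proof -
    have "f t = path_fun \<pi> t" "f (real m - 1) = path_fun \<pi> (real m - 1)"
      using that by (auto intro!: L[rule_format])
    then show ?thesis using path_fun_linear[of m t \<pi>] that by simp
  qed
  have "continuous_on {0..real (2 * n)} f"
    using continuous_path_fun[of "2 * n" \<pi>] continuous_on_cong[of "{0..real (2*n)}" _ f "path_fun \<pi>"] L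
    by blast
  moreover have "f 0 = 0" using L path_fun_0 by simp
  moreover have "f t = f (real i - 1) + (t - (real i - 1))"
    if "{i, j} \<in> \<pi>" "i < j" "t \<in> {real i - 1..real i}" for i j t
    using lin[of i t] NC2_slope[OF \<pi> that(1,2)] that(3) by simp
  moreover have "f t = f (real j - 1) - (t - (real j - 1))"
    if "{i, j} \<in> \<pi>" "i < j" "t \<in> {real j - 1..real j}" for i j t
    using lin[of j t] NC2_slope[OF \<pi> that(1,2)] that(3) by simp
  ultimately show ?R by blast
next
  assume R: ?R
  have lin: "f t = f (real m - 1) + slope \<pi> m * (t - (real m - 1))"
    if m: "m \<in> {1..2*n}" "t \<in> {real m - 1..real m}" for m t
  proof -
    obtain i j where ij: "i < j" "{i, j} \<in> \<pi>" "m = i \<or> m = j"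
      using NC2_cover[OF \<pi> m(1)] by blast
    note sl = NC2_slope(1,2)[OF \<pi> ij(2,1)]
    from ij(3) show ?thesis
    proof
      assume mi: "m = i"
      have "f t = f (real i - 1) + (t - (real i - 1))"
        using R ij(1,2) m(2) mi by blast
      then show ?thesis unfolding mi sl mult_1 .
    next
      assume mj: "m = j"
      have "f t = f (real j - 1) - (t - (real j - 1))"
        using R ij(1,2) m(2) mj by blast
      then show ?thesis unfolding mj sl by (simp only: mult_minus1 diff_conv_add_uminus)
    qed
  qed
  have "N \<le> 2 * n \<Longrightarrow> \<forall>t\<in>{0..real N}. f t = path_fun \<pi> t" for N
  proof (induction N)
    case 0
    then show ?case using R path_fun_0 by simp
  next
    case (Suc N)
    show ?case
    proof
      fix t assume t: "t \<in> {0..real (Suc N)}"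
      show "f t = path_fun \<pi> t"
      proof (cases "t \<le> real N")
        case True
        then show ?thesis using Suc t by simp
      next
        case False
        then have t': "t \<in> {real (Suc N) - 1..real (Suc N)}" using t by simp
        have "f (real (Suc N) - 1) = path_fun \<pi> (real (Suc N) - 1)" using Suc by simp
        then show ?thesis
          using lin[of "Suc N" t] path_fun_linear[of "Suc N" t \<pi>] t' Suc.prems by simp
      qed
    qed
  qed
  then show ?L by blast
qed

text \<open>\<^const>\<open>pmf_of_set\<close> is only meaningful on finite non-empty sets.\<close>

lemma finite_NC2_mton: "finite (NC2_mton n)"
proof (rule finite_subset)
  show "NC2_mton n \<subseteq> (SIGMA \<pi>:Pow (Pow {1..2*n}). \<pi> \<rightarrow>\<^sub>E {1..n})"
    by (auto simp: NC2_mton_def NC2_def monotonic_ordering_def partition_on_def PiE_def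
        dest: bij_betw_apply)
  show "finite (SIGMA \<pi>:Pow (Pow {1..2*n}). \<pi> \<rightarrow>\<^sub>E {1..n})"
    by (intro finite_SigmaI finite_PiE) (auto intro: finite_subset)
qed

lemma NC2_mton_nonempty: "NC2_mton n \<noteq> {}"
proof -
  define b :: "nat \<Rightarrow> nat set" where "b k = {2 * k - 1, 2 * k}" for k
  define \<pi> where "\<pi> = b ` {1..n}"
  define u where "u = restrict (the_inv_into {1..n} b) \<pi>"
  have Mn: "Min (b k) = 2 * k - 1" "Max (b k) = 2 * k" for k
    by (auto simp: b_def)
  have inj: "inj_on b {1..n}"
    by (rule inj_onI) (metis Mn(2) mult_cancel1 zero_neq_numeral)
  have "bij_betw (the_inv_into {1..n} b) \<pi> {1..n}"
    unfolding \<pi>_def using inj by (intro bij_betw_the_inv_into inj_on_imp_bij_betw)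
  then have bij: "bij_betw u \<pi> {1..n}"
    unfolding u_def by (simp cong: bij_betw_cong)
  have un: "\<Union>\<pi> = {1..2*n}"
  proof
    show "\<Union>\<pi> \<subseteq> {1..2*n}" by (auto simp: \<pi>_def b_def)
    show "{1..2*n} \<subseteq> \<Union>\<pi>"
    proof
      fix m assume "m \<in> {1..2*n}"
      then have "(m + 1) div 2 \<in> {1..n}" "m \<in> b ((m + 1) div 2)" by (auto simp: b_def)
      then show "m \<in> \<Union>\<pi>" unfolding \<pi>_def by blast
    qed
  qed
  have b_div: "k = (m + 1) div 2" if "m \<in> b k" "k \<ge> 1" for m k
    using that by (auto simp: b_def)
  have "disjoint \<pi>"
  proof (rule disjointI)
    fix V W assume "V \<in> \<pi>" "W \<in> \<pi>" "V \<noteq> W"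
    then obtain k l where "k \<in> {1..n}" "V = b k" "l \<in> {1..n}" "W = b l"
      unfolding \<pi>_def by (elim imageE)
    with \<open>V \<noteq> W\<close> have kl: "V = b k" "W = b l" "k \<ge> 1" "l \<ge> 1" "k \<noteq> l" by auto
    show "V \<inter> W = {}"
      using b_div[OF _ kl(3)] b_div[OF _ kl(4)] kl(5) unfolding kl(1,2)
      by (metis disjoint_iff)
  qed
  then have "partition_on {1..2*n} \<pi>"
    using un by (auto simp: partition_on_def) (auto simp: \<pi>_def b_def)
  moreover have "\<forall>V\<in>\<pi>. card V = 2" by (auto simp: \<pi>_def b_def)
  moreover have "non_crossing \<pi>"
  proof -
    have "y \<le> x + 1" if "x \<in> V" "y \<in> V" "V \<in> \<pi>" for x y V
      using that by (auto simp: \<pi>_def b_def)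
    then show ?thesis unfolding non_crossing_def
      by (metis Suc_eq_plus1 Suc_leI leD less_le_trans)
  qed
  moreover have "\<not> nested_inside V W" if "V \<in> \<pi>" "W \<in> \<pi>" for V W
    using that by (auto simp: \<pi>_def nested_inside_def Mn)
  ultimately have "(\<pi>, u) \<in> NC2_mton n"
    using bij by (auto simp: NC2_mton_def NC2_def monotonic_ordering_def u_def)
  then show ?thesis by blast
qed

end

theory Submission
  imports Defs "HOL-Real_Asymp.Real_Asymp"
begin

text \<open>The block with the largest label has no block nested inside it, so it is a pair of neighbours
  \<open>{p + 1, p + 2}\<close>. Deleting it leaves an arbitrary element of the set for \<open>n - 1\<close>, and \<open>p\<close> can be
  any of \<open>0, \<dots>, 2 * n - 2\<close>; hence every element for \<open>n\<close> has \<open>2 * n + 1\<close> successors. The area is the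
  sum of \<open>j - i\<close> over the pairs \<open>i < j\<close>, and an insertion at \<open>p\<close> adds 1 for the new pair and 2 for
  each pair with \<open>i \<le> p < j\<close>. Summing over \<open>p\<close>, the successors of an element of area \<open>a\<close> have total
  area \<open>(2 * n + 3) * a + (2 * n + 1)\<close>. So \<open>E[A\<^sub>n] / (2 * n + 1)\<close> grows by \<open>1 / (2 * n + 1)\<close> in the
  step from \<open>n - 1\<close> to \<open>n\<close>. The asymptotics follow by comparison with harmonic numbers.\<close>

section \<open>Lists of arcs\<close>

text \<open>The increasing enumeration of the naturals other than \<open>p + 1\<close> and
  \<open>p + 2\<close>: points beyond \<open>p\<close> move up to make room for a new pair.\<close>

definition open_gap :: "nat \<Rightarrow> nat \<Rightarrow> nat" where
  "open_gap p x = (if x \<le> p then x else x + 2)"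

definition endpoints :: "(nat \<times> nat) list \<Rightarrow> nat list" where
  "endpoints xs = map fst xs @ map snd xs"

definition avoids :: "nat \<times> nat \<Rightarrow> nat \<times> nat \<Rightarrow> bool" where
  "avoids a b \<longleftrightarrow> {fst a, snd a} \<inter> {fst b<..<snd b} = {}"

text \<open>An ordered pairing is encoded as the list of its pairs by increasing label. For such a list,
  non-crossing together with monotonicity says exactly that an arc never has an endpoint strictly
  between those of a later arc.\<close>

definition arc_lists :: "nat \<Rightarrow> (nat \<times> nat) list set" where
  "arc_lists n = {xs. length xs = n \<and> (\<forall>a\<in>set xs. fst a < snd a) \<and>
     distinct (endpoints xs) \<and> set (endpoints xs) = {1..2 * n} \<and> sorted_wrt avoids xs}"

definition insert_arc :: "nat \<Rightarrow> (nat \<times> nat) list \<Rightarrow> (nat \<times> nat) list" where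
  "insert_arc p xs = map (map_prod (open_gap p) (open_gap p)) xs @ [(p + 1, p + 2)]"

text \<open>This is the area of the encoded pairing, as the last part of
  \<open>arcs_of_properties\<close> confirms.\<close>

definition weight :: "(nat \<times> nat) list \<Rightarrow> real" where
  "weight xs = (\<Sum>a\<leftarrow>xs. real (snd a) - real (fst a))"

section \<open>Inserting a pair of neighbours as the last arc\<close>

lemma open_gap_less_iff [simp]: "open_gap p x < open_gap p y \<longleftrightarrow> x < y"
  by (auto simp: open_gap_def)

lemma inj_open_gap: "inj (open_gap p)"
  by (rule injI) (metis open_gap_less_iff linorder_less_linear less_irrefl)

lemma open_gap_eq_iff [simp]: "open_gap p x = open_gap p y \<longleftrightarrow> x = y"
  using inj_open_gap by (auto simp: inj_def)

lemma open_gap_neq [simp]: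
  "open_gap p x \<noteq> Suc p" "open_gap p x \<noteq> Suc (Suc p)"
  "Suc p \<noteq> open_gap p x" "Suc (Suc p) \<noteq> open_gap p x"
  by (auto simp: open_gap_def)

lemma open_gap_image:
  assumes "p \<le> m"
  shows "open_gap p ` {1..m} = {1..m + 2} - {p + 1, p + 2}"
proof
  show "open_gap p ` {1..m} \<subseteq> {1..m + 2} - {p + 1, p + 2}"
    by (auto simp: open_gap_def)
  show "{1..m + 2} - {p + 1, p + 2} \<subseteq> open_gap p ` {1..m}"
  proof
    fix y assume y: "y \<in> {1..m + 2} - {p + 1, p + 2}"
    have "y = open_gap p (if y \<le> p then y else y - 2)" "(if y \<le> p then y else y - 2) \<in> {1..m}"
      using y assms by (auto simp: open_gap_def)
    then show "y \<in> open_gap p ` {1..m}" by (rule image_eqI)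
  qed
qed

lemma avoids_open_gap [simp]:
  "avoids (map_prod (open_gap p) (open_gap p) a) (map_prod (open_gap p) (open_gap p) b) \<longleftrightarrow> avoids a b"
  by (auto simp: avoids_def)

text \<open>Since \<open>open_gap p\<close> preserves and reflects the order, relabelling affects
  none of the conditions on the old arcs; the new arc comes last and encloses no point. The
  direction from left to right serves to undo an insertion.\<close>

lemma insert_arc_in_arc_lists_iff:
  assumes "p \<le> 2 * n"
  shows "insert_arc p xs \<in> arc_lists (Suc n) \<longleftrightarrow> xs \<in> arc_lists n"
proof -
  have d: "distinct (endpoints (insert_arc p xs)) \<longleftrightarrow> distinct (map (open_gap p) (endpoints xs))"
    unfolding endpoints_def insert_arc_def by auto
  have "set (endpoints (insert_arc p xs)) = {p + 1, p + 2} \<union> open_gap p ` set (endpoints xs)"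
    unfolding endpoints_def insert_arc_def by (auto simp: image_iff)
  moreover have "{1..2 * Suc n} = {p + 1, p + 2} \<union> open_gap p ` {1..2 * n}"
    unfolding open_gap_image[OF assms] using assms by auto
  \<comment> \<open>The image of \<open>open_gap p\<close> misses the two new points, so they can be
    cancelled, and then injectivity applies.\<close>
  moreover have "X = Y" if "{p + 1, p + 2} \<union> open_gap p ` X = {p + 1, p + 2} \<union> open_gap p ` Y" for X Y
  proof -
    have "{p + 1, p + 2} \<inter> open_gap p ` Z = {}" for Z by auto
    with that have "open_gap p ` X = open_gap p ` Y" by blast
    then show ?thesis by (simp add: inj_image_eq_iff[OF inj_open_gap])
  qed
  ultimately have s: "set (endpoints (insert_arc p xs)) = {1..2 * Suc n} \<longleftrightarrow>
      set (endpoints xs) = {1..2 * n}"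
    by metis
  have w: "sorted_wrt avoids (insert_arc p xs) \<longleftrightarrow> sorted_wrt avoids xs"
  proof -
    have "avoids (map_prod (open_gap p) (open_gap p) a) (p + 1, p + 2)" for a
      by (auto simp: avoids_def)
    then show ?thesis
      unfolding insert_arc_def by (simp add: sorted_wrt_append sorted_wrt_map)
  qed
  show ?thesis
    unfolding arc_lists_def mem_Collect_eq d s w
    by (auto simp: insert_arc_def distinct_map intro: inj_on_subset[OF inj_open_gap])
qed

text \<open>The last arc reveals \<open>p\<close>, and the relabelling is injective, so an insertion
  can be read off from its result. For surjectivity the last arc has to join neighbours.\<close>

lemma bij_betw_insert_arc:
  "bij_betw (\<lambda>(xs, p). insert_arc p xs) (arc_lists n \<times> {..2 * n}) (arc_lists (Suc n))"
proof (intro bij_betw_imageI)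
  show "inj_on (\<lambda>(xs, p). insert_arc p xs) (arc_lists n \<times> {..2 * n})"
  proof (rule inj_onI, clarify)
    fix xs p ys q assume eq: "insert_arc p xs = insert_arc q ys"
    then have [simp]: "q = p" by (simp add: insert_arc_def)
    from eq have "map (map_prod (open_gap p) (open_gap p)) xs = map (map_prod (open_gap p) (open_gap p)) ys"
      by (simp add: insert_arc_def)
    then have "xs = ys" by (rule map_injective) (rule prod.inj_map[OF inj_open_gap inj_open_gap])
    then show "xs = ys \<and> p = q" by simp
  qed
  show "(\<lambda>(xs, p). insert_arc p xs) ` (arc_lists n \<times> {..2 * n}) = arc_lists (Suc n)"
  proof (intro subset_antisym subsetI)
    fix ys assume "ys \<in> (\<lambda>(xs, p). insert_arc p xs) ` (arc_lists n \<times> {..2 * n})"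
    then show "ys \<in> arc_lists (Suc n)" using insert_arc_in_arc_lists_iff by auto
  next
    fix ys assume ys: "ys \<in> arc_lists (Suc n)"
    then obtain zs i j where zs: "ys = zs @ [(i, j)]"
      by (cases ys rule: rev_cases) (auto simp: arc_lists_def)
    have ij: "i < j" and dis: "i \<notin> set (endpoints zs)" "j \<notin> set (endpoints zs)"
      and pts: "insert i (insert j (set (endpoints zs))) = {1..2 * Suc n}"
      and av: "\<And>a. a \<in> set zs \<Longrightarrow> avoids a (i, j)"
      using ys by (auto simp: zs arc_lists_def endpoints_def sorted_wrt_append)
    \<comment> \<open>Otherwise the point \<open>i + 1\<close> would belong to an earlier arc while
      lying strictly inside the last one.\<close>
    have "j = i + 1"
    proof (rule ccontr)
      assume "j \<noteq> i + 1"
      with ij have "i + 1 < j" by simp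
      moreover from this have "i + 1 \<in> {1..2 * Suc n}"
        using eqset_imp_iff[OF pts, of j] by auto
      ultimately have "i + 1 \<in> set (endpoints zs)" unfolding pts[symmetric] by simp
      then obtain a where "a \<in> set zs" "i + 1 = fst a \<or> i + 1 = snd a"
        by (auto simp: endpoints_def)
      with av[of a] \<open>i + 1 < j\<close> show False by (auto simp: avoids_def)
    qed
    moreover define p where "p = i - 1"
    moreover have "i \<ge> 1" "j \<le> 2 * Suc n"
      using eqset_imp_iff[OF pts, of i] eqset_imp_iff[OF pts, of j] by auto
    ultimately have p: "i = p + 1" "j = p + 2" "p \<le> 2 * n" by auto
    \<comment> \<open>The remaining endpoints avoid \<open>p + 1\<close> and \<open>p + 2\<close>,
      so every earlier arc has a preimage under the relabelling.\<close>
    have sub: "set (endpoints zs) \<subseteq> range (open_gap p)"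
    proof -
      have "set (endpoints zs) = {1..2 * n + 2} - {p + 1, p + 2}"
        using pts dis p by auto
      then show ?thesis using open_gap_image[OF p(3)] by blast
    qed
    have "\<exists>xs. zs = map (map_prod (open_gap p) (open_gap p)) xs"
    proof -
      have "a \<in> range (map_prod (open_gap p) (open_gap p))" if "a \<in> set zs" for a
        using sub that by (cases a) (force simp: endpoints_def)
      then show ?thesis by (metis ex_map_conv rangeE)
    qed
    then obtain xs where "zs = map (map_prod (open_gap p) (open_gap p)) xs" ..
    then have *: "ys = insert_arc p xs" by (simp add: zs insert_arc_def p)
    then have "xs \<in> arc_lists n" using ys insert_arc_in_arc_lists_iff p(3) by simp
    with * p(3) show "ys \<in> (\<lambda>(xs, p). insert_arc p xs) ` (arc_lists n \<times> {..2 * n})" by auto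
  qed
qed

text \<open>An arc \<open>(l, r)\<close> has length \<open>r - l\<close> in each of the
  \<open>2 * n + 1\<close> insertions and gains 2 in \<open>r - l\<close> of them, whence the factor
  \<open>2 * n + 3\<close>. The hypothesis concerns single arcs only, so it passes to the tail in
  the induction.\<close>

lemma sum_weight_insert_arc:
  assumes "\<forall>a\<in>set xs. fst a < snd a \<and> snd a \<le> 2 * n"
  shows "(\<Sum>p\<le>2 * n. weight (insert_arc p xs)) = (2 * real n + 3) * weight xs + (2 * real n + 1)"
  using assms
proof (induction xs)
  case Nil
  then show ?case by (simp add: weight_def insert_arc_def)
next
  case (Cons a xs)
  obtain l r where a: "a = (l, r)" by fastforce
  have lr: "l < r" "r \<le> 2 * n" using Cons.prems a by auto
  have "real (open_gap p r) - real (open_gap p l) = real r - real l + (if p \<in> {l..<r} then 2 else 0)" for p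
    using lr by (auto simp: open_gap_def)
  then have w: "weight (insert_arc p (a # xs)) =
      real r - real l + (if p \<in> {l..<r} then 2 else 0) + weight (insert_arc p xs)" for p
    by (simp add: weight_def insert_arc_def a)
  \<comment> \<open>As \<open>r \<le> 2 * n\<close>, all \<open>r - l\<close> stretching positions
    occur in the sum.\<close>
  have i: "(\<Sum>p\<le>2 * n. if p \<in> {l..<r} then 2 else 0 :: real) = 2 * (real r - real l)"
  proof -
    have "{..2 * n} \<inter> {l..<r} = {l..<r}" using lr by auto
    then show ?thesis using lr by (simp add: sum.If_cases del: atLeastLessThan_iff)
  qed
  have "weight (a # xs) = real r - real l + weight xs" by (simp add: weight_def a)
  moreover have "(\<Sum>p\<le>2 * n. weight (insert_arc p xs)) = (2 * real n + 3) * weight xs + (2 * real n + 1)"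
    using Cons by simp
  ultimately show ?case unfolding w
    by (simp only: sum.distrib sum_constant i) (simp add: algebra_simps)
qed

section \<open>Number and average weight of arc lists\<close>

lemma card_arc_lists_Suc: "card (arc_lists (Suc n)) = (2 * n + 1) * card (arc_lists n)"
  using bij_betw_same_card[OF bij_betw_insert_arc[of n]] by (simp add: card_cartesian_product algebra_simps)

lemma card_arc_lists_pos: "card (arc_lists n) > 0"
proof (induction n)
  case 0
  have "arc_lists 0 = {[]}" by (auto simp: arc_lists_def endpoints_def)
  then show ?case by simp
qed (simp add: card_arc_lists_Suc)

lemma sum_weight_arc_lists_Suc:
  "(\<Sum>xs\<in>arc_lists (Suc n). weight xs) =
    (2 * real n + 3) * (\<Sum>xs\<in>arc_lists n. weight xs) + (2 * real n + 1) * card (arc_lists n)"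
proof -
  have "(\<Sum>xs\<in>arc_lists (Suc n). weight xs) =
      (\<Sum>(xs, p)\<in>arc_lists n \<times> {..2 * n}. weight (insert_arc p xs))"
    unfolding sum.reindex_bij_betw[OF bij_betw_insert_arc[of n], of weight, symmetric]
    by (simp only: case_prod_unfold)
  also have "\<dots> = (\<Sum>xs\<in>arc_lists n. \<Sum>p\<le>2 * n. weight (insert_arc p xs))"
    by (rule sum.cartesian_product[symmetric])
  also have "\<dots> = (\<Sum>xs\<in>arc_lists n. (2 * real n + 3) * weight xs + (2 * real n + 1))"
  proof (intro sum.cong refl sum_weight_insert_arc ballI)
    fix xs a assume "xs \<in> arc_lists n" and a: "a \<in> set xs"
    then have "fst a < snd a" "set (endpoints xs) = {1..2 * n}"
      by (auto simp: arc_lists_def)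
    moreover have "snd a \<in> set (endpoints xs)" using a by (simp add: endpoints_def)
    ultimately show "fst a < snd a \<and> snd a \<le> 2 * n" by simp
  qed
  finally show ?thesis by (simp add: sum.distrib sum_distrib_left)
qed

lemma average_weight_arc_lists:
  "(\<Sum>xs\<in>arc_lists n. weight xs) / card (arc_lists n) =
    (2 * real n + 1) * (\<Sum>k=1..n. 1 / (2 * real k + 1))"
proof (induction n)
  case 0
  have "arc_lists 0 = {[]}" by (auto simp: arc_lists_def endpoints_def)
  then show ?case by (simp add: weight_def)
next
  case (Suc n)
  define S where "S = (\<Sum>k=1..n. 1 / (2 * real k + 1))"
  have pos: "real (card (arc_lists n)) > 0" using card_arc_lists_pos by simp
  have "(\<Sum>xs\<in>arc_lists n. weight xs) = (2 * real n + 1) * S * card (arc_lists n)"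
    using Suc pos by (simp add: S_def field_simps)
  \<comment> \<open>Both terms of the recursion contain \<open>2 * n + 1\<close>, which turns the
    cardinality for \<open>n\<close> into that for \<open>Suc n\<close>.\<close>
  then have "(\<Sum>xs\<in>arc_lists (Suc n). weight xs) =
     ((2 * real n + 3) * S + 1) * card (arc_lists (Suc n))"
    unfolding sum_weight_arc_lists_Suc card_arc_lists_Suc by (simp add: algebra_simps)
  then have "(\<Sum>xs\<in>arc_lists (Suc n). weight xs) / card (arc_lists (Suc n)) =
     (2 * real n + 3) * S + 1"
    using card_arc_lists_pos[of "Suc n"] by simp
  also have "\<dots> = (2 * real (Suc n) + 1) * (S + 1 / (2 * real (Suc n) + 1))"
    by (simp add: distrib_left)
  finally show ?case by (simp add: S_def)
qed

section \<open>Sums of reciprocals of odd numbers\<close>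

text \<open>The even denominators in \<open>harm (2 * n + 1)\<close> contribute
  \<open>harm n / 2\<close>; the final 1 is the term with denominator 1.\<close>

lemma sum_inverse_odd_harm:
  "(\<Sum>k=1..n. 1 / (2 * real k + 1)) = harm (2 * n + 1) - harm n / 2 - 1"
proof (induction n)
  case (Suc n)
  have "harm (2 * Suc n + 1) = harm (2 * n + 1) + 1 / (2 * real (Suc n)) + 1 / (2 * real (Suc n) + 1)"
    by (simp add: harm_Suc inverse_eq_divide add.commute)
  moreover have "harm (Suc n) / 2 = harm n / 2 + 1 / (2 * real (Suc n))"
    by (simp add: harm_Suc field_simps)
  moreover have "(\<Sum>k=1..Suc n. 1 / (2 * real k + 1)) =
      (\<Sum>k=1..n. 1 / (2 * real k + 1)) + 1 / (2 * real (Suc n) + 1)" by simp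
  ultimately show ?case using Suc by linarith
qed (simp add: harm_def)

lemma sum_inverse_odd_minus_ln_LIMSEQ:
  "(\<lambda>n. (\<Sum>k=1..n. 1 / (2 * real k + 1)) - ln (real n) / 2)
     \<longlonglongrightarrow> euler_mascheroni / 2 + ln 2 - 1"
proof -
  let ?h = "\<lambda>n. harm n - ln (real n) :: real"
  have h: "?h \<longlonglongrightarrow> euler_mascheroni" by (rule euler_mascheroni_LIMSEQ)
  have "filterlim (\<lambda>n::nat. 2 * n + 1) sequentially sequentially" by real_asymp
  from filterlim_compose[OF h this]
  have h': "(\<lambda>n. ?h (2 * n + 1)) \<longlonglongrightarrow> euler_mascheroni" .
  have l: "(\<lambda>n. ln (real (2 * n + 1)) - ln (real n)) \<longlonglongrightarrow> ln 2"
    by real_asymp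
  \<comment> \<open>Each harmonic number is paired with its own logarithm; the leftover logarithms
    tend to \<open>ln 2\<close>.\<close>
  have "(\<lambda>n. ?h (2 * n + 1) - ?h n / 2 + (ln (real (2 * n + 1)) - ln (real n)) - 1)
      \<longlonglongrightarrow> euler_mascheroni - euler_mascheroni / 2 + ln 2 - 1"
    by (intro tendsto_intros h h' l) simp
  moreover have "?h (2 * n + 1) - ?h n / 2 + (ln (real (2 * n + 1)) - ln (real n)) - 1 =
      (\<Sum>k=1..n. 1 / (2 * real k + 1)) - ln (real n) / 2" for n
    by (simp only: sum_inverse_odd_harm diff_divide_distrib)
  ultimately show ?thesis by simp
qed

lemma sum_inverse_odd_asymp_equiv:
  "(\<lambda>n. (2 * real n + 1) * (\<Sum>k=1..n. 1 / (2 * real k + 1)))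
     \<sim>[sequentially] (\<lambda>n. real n * ln (real n))"
proof -
  \<comment> \<open>Since \<open>d\<close> converges, it vanishes after division by
    \<open>ln n\<close>; the ratio of the two sides then tends to
    \<open>2 * (1 / 2)\<close>.\<close>
  define d where "d n = (\<Sum>k=1..n. 1 / (2 * real k + 1)) - ln (real n) / 2" for n
  have d: "d \<longlonglongrightarrow> euler_mascheroni / 2 + ln 2 - 1"
    unfolding d_def by (rule sum_inverse_odd_minus_ln_LIMSEQ)
  have a: "(\<lambda>n. (2 * real n + 1) / real n) \<longlonglongrightarrow> 2" by real_asymp
  have b: "(\<lambda>n. 1 / ln (real n)) \<longlonglongrightarrow> 0" by real_asymp
  have "(\<lambda>n. (2 * real n + 1) / real n * (1 / 2 + d n * (1 / ln (real n))))
      \<longlonglongrightarrow> 2 * (1 / 2 + (euler_mascheroni / 2 + ln 2 - 1) * 0)"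
    by (intro tendsto_intros a b d)
  then have "(\<lambda>n. (2 * real n + 1) / real n * (1 / 2 + d n * (1 / ln (real n)))) \<longlonglongrightarrow> 1"
    by simp
  \<comment> \<open>For \<open>n > 1\<close> both \<open>n\<close> and \<open>ln n\<close> are
    nonzero, so the division is genuine.\<close>
  moreover have "\<forall>\<^sub>F n in sequentially. (2 * real n + 1) / real n * (1 / 2 + d n * (1 / ln (real n)))
      = (2 * real n + 1) * (\<Sum>k=1..n. 1 / (2 * real k + 1)) / (real n * ln (real n))"
    using eventually_gt_at_top[of 1] by eventually_elim (simp add: d_def field_simps)
  ultimately show ?thesis by (intro asymp_equivI') (rule Lim_transform_eventually)
qed

section \<open>The area as a sum over blocks\<close>

text \<open>The slope of step \<open>m\<close> contributes half of itself over its own unit interval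
  and all of itself over each of the \<open>N - m\<close> later ones.\<close>

lemma integral_path_fun:
  "(path_fun \<pi> has_integral (\<Sum>m=1..N. slope \<pi> m * (real N - real m + 1 / 2))) {0..real N}"
proof (induction N)
  case 0
  show ?case using has_integral_refl(2)[of "path_fun \<pi>" "0 :: real"] by simp
next
  case (Suc N)
  let ?g = "\<lambda>t. path_fun \<pi> (real N) + slope \<pi> (Suc N) * (t - real N)"
  let ?G = "\<lambda>t. path_fun \<pi> (real N) * t + slope \<pi> (Suc N) * ((t - real N)\<^sup>2 / 2)"
  have "(?g has_integral (?G (real (Suc N)) - ?G (real N))) {real N..real (Suc N)}"
  proof (rule fundamental_theorem_of_calculus)
    fix t
    have "(?G has_real_derivative ?g t) (at t within {real N..real (Suc N)})"
      by (rule derivative_eq_intros refl | simp)+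
    then show "(?G has_vector_derivative ?g t) (at t within {real N..real (Suc N)})"
      by (simp only: has_real_derivative_iff_has_vector_derivative)
  qed simp
  moreover have "?G (real (Suc N)) - ?G (real N) = path_fun \<pi> (real N) + slope \<pi> (Suc N) / 2"
    by (simp add: distrib_left)
  ultimately have "(?g has_integral (path_fun \<pi> (real N) + slope \<pi> (Suc N) / 2)) {real N..real (Suc N)}"
    by (simp only:)
  then have "(path_fun \<pi> has_integral (path_fun \<pi> (real N) + slope \<pi> (Suc N) / 2))
      {real N..real (Suc N)}"
  proof (rule has_integral_eq[rotated])
    fix t assume "t \<in> {real N..real (Suc N)}"
    then have "path_fun \<pi> t = path_fun \<pi> (real (Suc N) - 1) + slope \<pi> (Suc N) * (t - (real (Suc N) - 1))"
      by (intro path_fun_linear) auto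
    then show "?g t = path_fun \<pi> t" by simp
  qed
  from has_integral_combine[OF _ _ Suc this]
  have "(path_fun \<pi> has_integral ((\<Sum>m=1..N. slope \<pi> m * (real N - real m + 1 / 2)) +
      (path_fun \<pi> (real N) + slope \<pi> (Suc N) / 2))) {0..real (Suc N)}" by simp
  moreover have "path_fun \<pi> (real N) = (\<Sum>m=1..N. slope \<pi> m)" by (simp add: path_fun_def)
  \<comment> \<open>Raising \<open>N\<close> by one raises every old coefficient by one, and the
    slopes so added sum to \<open>path_fun \<pi> (real N)\<close>.\<close>
  moreover have "(\<Sum>m=1..Suc N. slope \<pi> m * (real (Suc N) - real m + 1 / 2)) =
      (\<Sum>m=1..N. slope \<pi> m * (real N - real m + 1 / 2) + slope \<pi> m) + slope \<pi> (Suc N) / 2"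
    by (simp add: algebra_simps)
  ultimately show ?case by (simp add: sum.distrib add.assoc)
qed

lemma NC2_block:
  assumes "\<pi> \<in> NC2 N" "V \<in> \<pi>"
  shows "Min V < Max V" "V = {Min V, Max V}"
proof -
  have "card V = 2" using assms by (auto simp: NC2_def)
  then obtain x y where "V = {x, y}" "x \<noteq> y" by (auto simp: card_2_iff)
  then show "Min V < Max V" "V = {Min V, Max V}" by (auto simp: min_def max_def)
qed

text \<open>Grouping the steps of the integral formula by blocks pairs slope 1 at the minimum with
  slope -1 at the maximum, so the constant \<open>2 * n + 1 / 2\<close> cancels.\<close>

lemma area_eq_sum_blocks:
  assumes "\<pi> \<in> NC2 (2 * n)"
  shows "area n \<pi> = (\<Sum>V\<in>\<pi>. real (Max V) - real (Min V))"
proof -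
  let ?g = "\<lambda>m. slope \<pi> m * (real (2 * n) - real m + 1 / 2)"
  have part: "partition_on {1..2 * n} \<pi>" using assms by (simp add: NC2_def)
  have "area n \<pi> = (\<Sum>m\<in>{1..2 * n}. ?g m)"
    unfolding area_def by (rule integral_unique[OF integral_path_fun])
  also have "{1..2 * n} = \<Union>\<pi>" using part by (simp add: partition_on_def)
  also have "(\<Sum>m\<in>\<Union>\<pi>. ?g m) = (\<Sum>V\<in>\<pi>. \<Sum>m\<in>V. ?g m)"
  proof (subst sum.Union_disjoint)
    show "\<forall>V\<in>\<pi>. finite V" using NC2_block(2)[OF assms] by (metis finite.emptyI finite.insertI)
    show "\<forall>V\<in>\<pi>. \<forall>W\<in>\<pi>. V \<noteq> W \<longrightarrow> V \<inter> W = {}"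
      using part by (auto simp: partition_on_def disjoint_def)
  qed simp
  also have "\<dots> = (\<Sum>V\<in>\<pi>. real (Max V) - real (Min V))"
  proof (rule sum.cong[OF refl])
    fix V assume V: "V \<in> \<pi>"
    note b = NC2_block[OF assms V]
    have "(\<Sum>m\<in>V. ?g m) = ?g (Min V) + ?g (Max V)"
      by (subst b(2)) (use b(1) in simp)
    moreover have "{Min V, Max V} \<in> \<pi>" using V b(2) by metis
    ultimately show "(\<Sum>m\<in>V. ?g m) = real (Max V) - real (Min V)"
      using NC2_slope(1,2)[OF assms _ b(1)] by simp
  qed
  finally show ?thesis .
qed

section \<open>Monotonically ordered pairings as lists of arcs\<close>

definition block :: "nat \<times> nat \<Rightarrow> nat set" where
  "block a = {fst a, snd a}"

text \<open>Positions in a list start at 0 and labels at 1, hence the \<open>Suc\<close>.\<close>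

definition arcs_of :: "nat \<Rightarrow> nat set set \<times> (nat set \<Rightarrow> nat) \<Rightarrow> (nat \<times> nat) list" where
  "arcs_of n = (\<lambda>(\<pi>, u). map (\<lambda>i. let V = inv_into \<pi> u (Suc i) in (Min V, Max V)) [0..<n])"

lemma Min_Max_block:
  assumes "fst a < snd a"
  shows "Min (block a) = fst a" "Max (block a) = snd a"
  using assms by (auto simp: block_def)

lemma set_endpoints: "set (endpoints xs) = (\<Union>a\<in>set xs. block a)"
  by (auto simp: endpoints_def block_def)

lemma disjoint_blocks:
  assumes "distinct (endpoints xs)" "i < length xs" "j < length xs" "i \<noteq> j"
  shows "block (xs ! i) \<inter> block (xs ! j) = {}"
proof -
  have d: "distinct (map fst xs)" "distinct (map snd xs)" "fst ` set xs \<inter> snd ` set xs = {}"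
    using assms(1) by (auto simp: endpoints_def)
  have "fst (xs ! i) \<noteq> fst (xs ! j)" "snd (xs ! i) \<noteq> snd (xs ! j)"
    using d(1,2) assms(2-4) by (auto simp: distinct_conv_nth)
  moreover have "fst (xs ! i) \<noteq> snd (xs ! j)" "fst (xs ! j) \<noteq> snd (xs ! i)"
    using d(3) nth_mem[OF assms(2)] nth_mem[OF assms(3)] by blast+
  ultimately show ?thesis by (auto simp: block_def)
qed

text \<open>Crossing arcs each have an endpoint strictly inside the other, and a nested arc has both
  inside the outer one. Avoidance thus excludes crossings and forces the nested arc to come
  later.\<close>

lemma NC2_mton_if_arc_lists:
  assumes xs: "xs \<in> arc_lists n"
    and u: "\<And>i. i < n \<Longrightarrow> u (block (xs ! i)) = Suc i"
    and ext: "u \<in> extensional (block ` set xs)"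
  shows "(block ` set xs, u) \<in> NC2_mton n"
proof -
  have len: "length xs = n" and dist: "distinct (endpoints xs)"
    and cover: "(\<Union>a\<in>set xs. block a) = {1..2 * n}" and sorted: "sorted_wrt avoids xs"
    using xs by (auto simp: arc_lists_def set_endpoints[symmetric])
  have lt: "fst (xs ! i) < snd (xs ! i)" if "i < n" for i
    using xs that by (simp add: arc_lists_def)
  have avoids: "avoids (xs ! i) (xs ! j)" if "i < j" "j < n" for i j
    using sorted_wrt_nth_less[OF sorted] that len by simp
  have disj: "block (xs ! i) \<inter> block (xs ! j) = {}" if "i < n" "j < n" "i \<noteq> j" for i j
    using disjoint_blocks[OF dist] that len by simp
  have idx: "\<exists>i<n. V = block (xs ! i)" if "V \<in> block ` set xs" for V
    using that len by (metis imageE in_set_conv_nth)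
  have part: "partition_on {1..2 * n} (block ` set xs)"
  proof (rule partition_onI)
    fix V W assume "V \<in> block ` set xs" "W \<in> block ` set xs" "V \<noteq> W"
    then show "disjnt V W" using idx disj unfolding disjnt_def by metis
  next
    show "\<Union> (block ` set xs) = {1..2 * n}" using cover by simp
    show "{} \<notin> block ` set xs" by (auto simp: block_def)
  qed
  have card: "card V = 2" if V: "V \<in> block ` set xs" for V
  proof -
    obtain i where "i < n" "V = block (xs ! i)" using idx[OF V] by blast
    then show ?thesis using lt[of i] by (simp add: block_def)
  qed
  have nc: "non_crossing (block ` set xs)"
  proof (unfold non_crossing_def, intro notI, elim bexE conjE exE)
    fix V W a b c d
    assume V: "V \<in> block ` set xs" and W: "W \<in> block ` set xs" and ne: "V \<noteq> W"
      and ord: "a < b" "b < c" "c < d" and mem: "a \<in> V" "c \<in> V" "b \<in> W" "d \<in> W"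
    obtain i j where ij: "i < n" "j < n" "V = block (xs ! i)" "W = block (xs ! j)"
      using idx[OF V] idx[OF W] by blast
    have "fst (xs ! i) = a" "snd (xs ! i) = c" "fst (xs ! j) = b" "snd (xs ! j) = d"
      using ord mem lt[OF ij(1)] lt[OF ij(2)] unfolding ij(3,4) block_def by auto
    \<comment> \<open>Either order is contradictory: \<open>c\<close> lies inside the arc from
      \<open>b\<close> to \<open>d\<close>, and \<open>b\<close> inside the arc from
      \<open>a\<close> to \<open>c\<close>.\<close>
    moreover have "i < j \<or> j < i" using ne ij by (metis linorder_less_linear)
    ultimately show False
      using avoids[of i j] avoids[of j i] ord ij(1,2) by (auto simp: avoids_def)
  qed
  have mono: "u W < u V"
    if V: "V \<in> block ` set xs" and W: "W \<in> block ` set xs" and nest: "nested_inside V W" for V W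
  proof -
    obtain i j where ij: "i < n" "j < n" "V = block (xs ! i)" "W = block (xs ! j)"
      using idx[OF V] idx[OF W] by blast
    have "fst (xs ! j) < fst (xs ! i)" "snd (xs ! i) < snd (xs ! j)"
      using nest lt[OF ij(1)] lt[OF ij(2)] by (auto simp: nested_inside_def ij Min_Max_block)
    then have "\<not> i < j" "i \<noteq> j"
      using avoids[of i j] lt[OF ij(1)] ij(2) by (auto simp: avoids_def)
    then show ?thesis using u ij by simp
  qed
  have bij: "bij_betw u (block ` set xs) {1..n}"
  proof (rule bij_betw_imageI)
    show "inj_on u (block ` set xs)"
      by (rule inj_onI) (metis idx u nat.inject)
    have "{1..n} = Suc ` {..<n}" by (rule image_Suc_lessThan[symmetric])
    also have "\<dots> = (\<lambda>i. u (block (xs ! i))) ` {..<n}" using u by simp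
    also have "\<dots> = u ` block ` set xs"
      using len by (auto simp: set_conv_nth image_image)
    finally show "u ` block ` set xs = {1..n}" ..
  qed
  show ?thesis
    unfolding NC2_mton_def NC2_def monotonic_ordering_def
    using part card nc mono bij ext by blast
qed

text \<open>If an earlier arc had an endpoint strictly inside a later one, its other endpoint would
  be inside too, against the order of the labels, or outside, which is a crossing.\<close>

lemma arc_lists_if_NC2_mton:
  assumes mton: "(block ` set xs, u) \<in> NC2_mton n"
    and len: "length xs = n"
    and lt: "\<And>i. i < n \<Longrightarrow> fst (xs ! i) < snd (xs ! i)"
    and u: "\<And>i. i < n \<Longrightarrow> u (block (xs ! i)) = Suc i"
  shows "xs \<in> arc_lists n"
proof -
  let ?\<pi> = "block ` set xs"
  have part: "partition_on {1..2 * n} ?\<pi>" and nc: "non_crossing ?\<pi>"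
    and mono: "\<And>V W. V \<in> ?\<pi> \<Longrightarrow> W \<in> ?\<pi> \<Longrightarrow> nested_inside V W \<Longrightarrow> u V > u W"
    using mton by (auto simp: NC2_mton_def NC2_def monotonic_ordering_def)
  have cover: "set (endpoints xs) = {1..2 * n}"
    using partition_onD1[OF part] by (simp add: set_endpoints)
  \<comment> \<open>By counting: \<open>2 * n\<close> entries cover \<open>2 * n\<close>
    points.\<close>
  moreover have dist: "distinct (endpoints xs)"
    by (rule card_distinct) (simp add: cover, simp add: endpoints_def len)
  moreover have "avoids (xs ! i) (xs ! j)" if ij: "i < j" "j < n" for i j
  proof -
    obtain a c where ac: "xs ! i = (a, c)" by fastforce
    obtain b d where bd: "xs ! j = (b, d)" by fastforce
    have "block (xs ! i) \<in> ?\<pi>" "block (xs ! j) \<in> ?\<pi>" using ij len by simp_all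
    then have mem: "{a, c} \<in> ?\<pi>" "{b, d} \<in> ?\<pi>" by (simp_all add: ac bd block_def)
    have lt': "a < c" "b < d" using lt[of i] lt[of j] ij ac bd by auto
    have disj: "{a, c} \<inter> {b, d} = {}"
      using disjoint_blocks[OF dist, of i j] ij len ac bd by (simp add: block_def)
    have "u {a, c} < u {b, d}" using u[of i] u[of j] ij ac bd by (simp add: block_def)
    then have "\<not> nested_inside {a, c} {b, d}" using mono[OF mem] by auto
    then have "\<not> (b < a \<and> c < d)" using lt' by (auto simp: nested_inside_def)
    moreover have "\<not> (x < y \<and> y < z \<and> z < w)"
      if "V \<in> ?\<pi>" "W \<in> ?\<pi>" "V \<noteq> W" "{x, z} \<subseteq> V" "{y, w} \<subseteq> W" for V W x y z w
      using nc that unfolding non_crossing_def by (metis insert_subset)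
    from this[OF mem, of a c b d] this[OF mem(2,1), of b d a c]
    have "\<not> (a < b \<and> b < c \<and> c < d)" "\<not> (b < a \<and> a < d \<and> d < c)"
      using disj by auto
    ultimately show ?thesis using lt' disj by (auto simp: avoids_def ac bd)
  qed
  moreover have "\<forall>a\<in>set xs. fst a < snd a" using lt len by (metis in_set_conv_nth)
  ultimately show ?thesis using len
    by (simp add: arc_lists_def sorted_wrt_iff_nth_less)
qed

text \<open>The list determines the pairing through its blocks and the ordering through its
  positions, which gives injectivity of the encoding.\<close>

lemma arcs_of_properties:
  assumes "(\<pi>, u) \<in> NC2_mton n"
  defines "xs \<equiv> arcs_of n (\<pi>, u)"
  shows "length xs = n" "\<And>i. i < n \<Longrightarrow> fst (xs ! i) < snd (xs ! i)"
    "\<pi> = block ` set xs" "\<And>i. i < n \<Longrightarrow> u (block (xs ! i)) = Suc i"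
    "weight xs = area n \<pi>"
proof -
  have \<pi>: "\<pi> \<in> NC2 (2 * n)" and u: "bij_betw u \<pi> {1..n}"
    using assms(1) by (auto simp: NC2_mton_def monotonic_ordering_def)
  \<comment> \<open>\<open>V\<close> enumerates the blocks by increasing label, so sums over blocks
    become sums over positions.\<close>
  define V where "V i = inv_into \<pi> u (Suc i)" for i
  have "bij_betw Suc {..<n} {1..n}"
    by (simp add: bij_betw_def image_Suc_lessThan)
  from bij_betw_trans[OF this bij_betw_inv_into[OF u]]
  have V: "bij_betw V {..<n} \<pi>" by (simp add: V_def[abs_def] comp_def)
  have mem: "V i \<in> \<pi>" if "i < n" for i using bij_betw_apply[OF V] that by simp
  show len: "length xs = n" by (simp add: xs_def arcs_of_def)
  have nth: "xs ! i = (Min (V i), Max (V i))" if "i < n" for i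
    using that by (simp add: xs_def arcs_of_def V_def Let_def)
  show "fst (xs ! i) < snd (xs ! i)" if "i < n" for i
    using NC2_block(1)[OF \<pi> mem] that by (simp add: nth)
  have block: "block (xs ! i) = V i" if "i < n" for i
    unfolding nth[OF that] block_def fst_conv snd_conv
    by (rule NC2_block(2)[OF \<pi> mem[OF that], symmetric])
  have "block ` set xs = (\<lambda>i. block (xs ! i)) ` {..<n}"
    using len by (auto simp: set_conv_nth image_image)
  also have "\<dots> = V ` {..<n}" using block by simp
  also have "\<dots> = \<pi>" using V by (simp add: bij_betw_def)
  finally show "\<pi> = block ` set xs" ..
  show "u (block (xs ! i)) = Suc i" if "i < n" for i
    using that block u by (simp add: V_def bij_betw_inv_into_right)
  have "area n \<pi> = (\<Sum>i<n. real (Max (V i)) - real (Min (V i)))"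
    unfolding area_eq_sum_blocks[OF \<pi>] by (rule sum.reindex_bij_betw[OF V, symmetric])
  also have "\<dots> = weight xs"
    unfolding weight_def sum_list_sum_nth using len nth by (simp add: lessThan_atLeast0)
  finally show "weight xs = area n \<pi>" ..
qed

lemma bij_betw_arcs_of: "bij_betw (arcs_of n) (NC2_mton n) (arc_lists n)"
proof (rule bij_betw_imageI)
  show "inj_on (arcs_of n) (NC2_mton n)"
  proof (rule inj_onI, clarify)
    fix \<pi> u \<rho> v assume mem: "(\<pi>, u) \<in> NC2_mton n" "(\<rho>, v) \<in> NC2_mton n"
      and eq: "arcs_of n (\<pi>, u) = arcs_of n (\<rho>, v)"
    note p = arcs_of_properties[OF mem(1)]
    note q = arcs_of_properties[OF mem(2), folded eq]
    have "\<pi> = \<rho>" using p(3) q(3) by simp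
    \<comment> \<open>Both orderings are \<open>undefined\<close> outside \<open>\<pi>\<close>, so
      agreement on the blocks suffices.\<close>
    moreover have "u = v"
    proof (rule extensionalityI)
      show "u \<in> extensional \<pi>" "v \<in> extensional \<pi>"
        using mem \<open>\<pi> = \<rho>\<close> by (auto simp: NC2_mton_def monotonic_ordering_def)
      fix V assume "V \<in> \<pi>"
      then obtain i where "i < n" "V = block (arcs_of n (\<pi>, u) ! i)"
        using p(1,3) by (metis imageE in_set_conv_nth)
      then show "u V = v V" using p(4) q(4) by simp
    qed
    ultimately show "\<pi> = \<rho> \<and> u = v" by simp
  qed
  show "arcs_of n ` NC2_mton n = arc_lists n"
  proof (intro subset_antisym subsetI)
    fix xs assume "xs \<in> arcs_of n ` NC2_mton n"
    then obtain \<pi> u where mem: "(\<pi>, u) \<in> NC2_mton n" and xs: "xs = arcs_of n (\<pi>, u)" by auto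
    note p = arcs_of_properties[OF mem, folded xs]
    show "xs \<in> arc_lists n"
      using mem p(1,2,4) unfolding p(3) by (rule arc_lists_if_NC2_mton)
  next
    fix xs assume xs: "xs \<in> arc_lists n"
    let ?b = "\<lambda>i. block (xs ! i)"
    have len: "length xs = n" and dist: "distinct (endpoints xs)"
      using xs by (auto simp: arc_lists_def)
    have inj: "inj_on ?b {..<n}"
    proof (rule inj_onI, rule ccontr)
      fix i j assume "i \<in> {..<n}" "j \<in> {..<n}" "?b i = ?b j" "i \<noteq> j"
      then show False using disjoint_blocks[OF dist, of i j] len by (simp add: block_def)
    qed
    define \<pi> where "\<pi> = block ` set xs"
    \<comment> \<open>The ordering decoded from a list labels each block with its position plus one;
      \<open>restrict\<close> makes it extensional.\<close>
    define u where "u = restrict (\<lambda>V. Suc (the_inv_into {..<n} ?b V)) \<pi>"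
    have b: "?b i \<in> \<pi>" if "i < n" for i using that len by (simp add: \<pi>_def)
    have u: "u (?b i) = Suc i" if "i < n" for i
      using that b the_inv_into_f_f[OF inj] by (simp add: u_def)
    have mem: "(\<pi>, u) \<in> NC2_mton n"
      unfolding \<pi>_def by (rule NC2_mton_if_arc_lists[OF xs u]) (simp_all add: u_def \<pi>_def del: restrict_apply)
    have inj_u: "inj_on u \<pi>"
      using mem by (auto simp: NC2_mton_def monotonic_ordering_def bij_betw_def)
    have "arcs_of n (\<pi>, u) = xs"
    proof (rule nth_equalityI)
      show "length (arcs_of n (\<pi>, u)) = length xs" by (simp add: arcs_of_def len)
      fix i assume "i < length (arcs_of n (\<pi>, u))"
      then have i: "i < n" by (simp add: arcs_of_def)
      have "inv_into \<pi> u (Suc i) = ?b i" by (rule inv_into_f_eq[OF inj_u b u]) (rule i)+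
      moreover have "fst (xs ! i) < snd (xs ! i)" using xs i by (simp add: arc_lists_def)
      ultimately show "arcs_of n (\<pi>, u) ! i = xs ! i"
        using i by (simp add: arcs_of_def Min_Max_block)
    qed
    with mem show "xs \<in> arcs_of n ` NC2_mton n" by (metis image_eqI)
  qed
qed

section \<open>The expected area and its growth\<close>

lemma expectation_area:
  "measure_pmf.expectation (pmf_of_set (NC2_mton n)) (A n) =
    (2 * real n + 1) * (\<Sum>k=1..n. 1 / (2 * real k + 1))"
proof -
  have "measure_pmf.expectation (pmf_of_set (NC2_mton n)) (A n) =
      (\<Sum>x\<in>NC2_mton n. A n x) / card (NC2_mton n)"
    by (rule integral_pmf_of_set[OF NC2_mton_nonempty finite_NC2_mton])
  also have "(\<Sum>x\<in>NC2_mton n. A n x) = (\<Sum>x\<in>NC2_mton n. weight (arcs_of n x))"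
    by (rule sum.cong) (auto simp: A_def arcs_of_properties(5))
  also have "\<dots> = (\<Sum>xs\<in>arc_lists n. weight xs)"
    by (rule sum.reindex_bij_betw[OF bij_betw_arcs_of])
  also have "card (NC2_mton n) = card (arc_lists n)"
    by (rule bij_betw_same_card[OF bij_betw_arcs_of])
  finally show ?thesis unfolding average_weight_arc_lists .
qed

theorem theorem1p11:
  shows "(\<forall>n. measure_pmf.expectation (pmf_of_set (NC2_mton n)) (A n)
            = (2 * real n + 1) * (\<Sum>k=1..n. 1 / (2 * real k + 1)))
       \<and> (\<lambda>n. measure_pmf.expectation (pmf_of_set (NC2_mton n)) (A n))
           \<sim>[sequentially] (\<lambda>n. real n * ln (real n))"
  using sum_inverse_odd_asymp_equiv by (simp only: expectation_area simp_thms)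

end
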